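(* Let $n\ge 1$ and let $Z=(Z_1,\dots,Z_n)'$ be a random vector with multivariate normal distribution with mean vector $\mu\in\mathbb{R}^n$ and covariance matrix $\Sigma\in\mathbb{R}^{n\times n}$, where $\Sigma$ is invertible and entrywise positive, i.e. $\mathrm{Cov}[Z_i,Z_j]>0$ for all $i,j=1,\dots,n$. Let $\alpha_1,\dots,\alpha_n>0$ and $S=\sum_{i=1}^n\alpha_i e^{Z_i}$. Let $\lambda_{pf}$ be the Perron-Frobenius eigenvalue of $\Sigma$ and let $x_{pf}=(\hat x_1,\dots,\hat x_n)'$ be the corresponding Perron-Frobenius eigenvector of norm $1$ (with all entries positive). Define $\lambda=(\lambda_1,\dots,\lambda_n)'=\Sigma^{-1}x_{pf}$, $\Lambda=\sum_{j=1}^n\lambda_j Z_j$ and $S^l=\mathrm{E}[S\mid\Lambda]=\sum_{i=1}^n \mathrm{E}[\alpha_i e^{Z_i}\mid\Lambda]$. Then $S^l$ is a comonotonic sum, that is, each of its components $\mathrm{E}[\alpha_i e^{Z_i}\mid\Lambda]$, $i=1,\dots,n$, is (almost surely) a non-decreasing function of $\Lambda$. Moreover, the correlation coefficient $r_i$ between $Z_i$ and $\Lambda$ is given by $$r_i=\frac{\sqrt{\lambda_{pf}}\,\hat x_i}{\sigma_{Z_i}}\qquad\text{for all } i=1,\dots,n.$$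
   Context: A prime denotes transpose and $\|\cdot\|$ is the Euclidean norm. $\sigma_{Z_i}=\sqrt{\mathrm{Var}[Z_i]}$ and $\sigma_\Lambda=\sqrt{\mathrm{Var}[\Lambda]}$. The correlation coefficient is $r_i=\mathrm{Cov}[Z_i,\Lambda]/(\sigma_{Z_i}\sigma_\Lambda)$. A matrix or vector is called positive (written $>0$) if all its entries are positive. For an entrywise positive square matrix $A$, the Perron-Frobenius eigenvalue $\lambda_{pf}$ is the real positive simple eigenvalue of $A$ satisfying $|\lambda|<\lambda_{pf}$ for every other eigenvalue $\lambda$ of $A$; its positive eigenvectors, called Perron-Frobenius eigenvectors, are unique up to positive scaling, and $x_{pf}$ denotes the one of unit norm. The components of $S^l=\mathrm{E}[S\mid\Lambda]$ are the terms $\mathrm{E}[\alpha_i e^{Z_i}\mid\Lambda]$; one says that the coefficient vector $\lambda$ "defines a comonotonic sum" if all these components are non-decreasing functions of $\Lambda$. *)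

theory Defs
  imports
    "HOL-Probability.Probability"
    "HOL-Computational_Algebra.Polynomial"
begin

text \<open>The measure \<open>M\<close> is meant to be a probability space; for square-integrable variables these
  are the usual notions.\<close>

definition covariance :: "'a measure \<Rightarrow> ('a \<Rightarrow> real) \<Rightarrow> ('a \<Rightarrow> real) \<Rightarrow> real" where
  "covariance M X Y =
     (LINT \<omega>|M. (X \<omega> - (LINT \<eta>|M. X \<eta>)) * (Y \<omega> - (LINT \<eta>|M. Y \<eta>)))"

definition std_dev :: "'a measure \<Rightarrow> ('a \<Rightarrow> real) \<Rightarrow> real" where
  "std_dev M X = sqrt (prob_space.variance M X)"

definition correlation :: "'a measure \<Rightarrow> ('a \<Rightarrow> real) \<Rightarrow> ('a \<Rightarrow> real) \<Rightarrow> real" where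
  "correlation M X Y = covariance M X Y / (std_dev M X * std_dev M Y)"

text \<open>Normal laws on the line, with the convention that a point mass is the normal law of
  standard deviation \<open>0\<close>.\<close>

definition univariate_normal :: "'a measure \<Rightarrow> ('a \<Rightarrow> real) \<Rightarrow> bool" where
  "univariate_normal M X \<longleftrightarrow>
     X \<in> borel_measurable M \<and>
     (\<exists>m s. distr M borel X = return borel m \<or>
            s > 0 \<and> distr M borel X = density lborel (\<lambda>x. ennreal (normal_density m s x)))"

text \<open>A random vector is multivariate normal if every linear combination of its coordinates is
  univariate normal. The case \<open>t = 0\<close> is the reason for admitting point masses above. The last two
  conditions say that \<open>\<mu>\<close> and \<open>C\<close> are the mean vector and the covariance matrix; moments of all
  orders exist, so no integrability needs to be required.\<close>

definition multivariate_normal ::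
    "'a measure \<Rightarrow> ('a \<Rightarrow> real ^ 'n) \<Rightarrow> real ^ 'n \<Rightarrow> real ^ 'n ^ 'n \<Rightarrow> bool" where
  "multivariate_normal M Z \<mu> C \<longleftrightarrow>
     Z \<in> borel_measurable M \<and>
     (\<forall>t :: real ^ 'n. univariate_normal M (\<lambda>\<omega>. \<Sum>i\<in>UNIV. t $ i * Z \<omega> $ i)) \<and>
     (\<forall>i. (LINT \<omega>|M. Z \<omega> $ i) = \<mu> $ i) \<and>
     (\<forall>i j. covariance M (\<lambda>\<omega>. Z \<omega> $ i) (\<lambda>\<omega>. Z \<omega> $ j) = C $ i $ j)"

text \<open>Eigenvalues of a real matrix are taken in the complex numbers; simple means of algebraic
  multiplicity \<open>1\<close>.
\<close>

definition charpoly :: "complex ^ 'n ^ 'n \<Rightarrow> complex poly" where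
  "charpoly A = det (mat [:0, 1:] - map_matrix (\<lambda>a. [:a:]) A)"

definition complex_eigenvalue :: "real ^ 'n ^ 'n \<Rightarrow> complex \<Rightarrow> bool" where
  "complex_eigenvalue A k \<longleftrightarrow>
     (\<exists>v. v \<noteq> 0 \<and> map_matrix complex_of_real A *v v = k *s v)"

definition simple_eigenvalue :: "real ^ 'n ^ 'n \<Rightarrow> complex \<Rightarrow> bool" where
  "simple_eigenvalue A k \<longleftrightarrow>
     complex_eigenvalue A k \<and> order k (charpoly (map_matrix complex_of_real A)) = 1"

definition pf_eigenvalue :: "real ^ 'n ^ 'n \<Rightarrow> real \<Rightarrow> bool" where
  "pf_eigenvalue A l \<longleftrightarrow>
     l > 0 \<and> simple_eigenvalue A (complex_of_real l) \<and>
     (\<forall>k. complex_eigenvalue A k \<and> k \<noteq> complex_of_real l \<longrightarrow> cmod k < l)"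

definition pf_eigenvector :: "real ^ 'n ^ 'n \<Rightarrow> real ^ 'n \<Rightarrow> bool" where
  "pf_eigenvector A x \<longleftrightarrow>
     (\<forall>i. x $ i > 0) \<and> (\<exists>l. pf_eigenvalue A l \<and> A *v x = l *s x)"

definition cond_exp_given :: "'a measure \<Rightarrow> ('a \<Rightarrow> real) \<Rightarrow> ('a \<Rightarrow> real) \<Rightarrow> 'a \<Rightarrow> real" where
  "cond_exp_given M X L = real_cond_exp M (vimage_algebra (space M) L borel) X"

definition nondecreasing_function_of :: "'a measure \<Rightarrow> ('a \<Rightarrow> real) \<Rightarrow> ('a \<Rightarrow> real) \<Rightarrow> bool" where
  "nondecreasing_function_of M Y L \<longleftrightarrow>
     (\<exists>g :: real \<Rightarrow> real. mono g \<and> (AE \<omega> in M. Y \<omega> = g (L \<omega>)))"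

definition lin_comb :: "real ^ 'n \<Rightarrow> ('a \<Rightarrow> real ^ 'n) \<Rightarrow> 'a \<Rightarrow> real" where
  "lin_comb c Z = (\<lambda>\<omega>. \<Sum>j\<in>UNIV. c $ j * Z \<omega> $ j)"

definition defines_comonotonic_sum ::
    "'a measure \<Rightarrow> real ^ 'n \<Rightarrow> ('a \<Rightarrow> real ^ 'n) \<Rightarrow> real ^ 'n \<Rightarrow> bool" where
  "defines_comonotonic_sum M \<alpha> Z c \<longleftrightarrow>
     (\<forall>i. nondecreasing_function_of M
            (cond_exp_given M (\<lambda>\<omega>. \<alpha> $ i * exp (Z \<omega> $ i)) (lin_comb c Z))
            (lin_comb c Z))"

end

theory Submission
  imports Defs
begin

text \<open>Since \<open>C *v x_pf = l_pf *s x_pf\<close>, the vector \<open>lam\<close> is \<open>x_pf / l_pf\<close>, and hence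
  \<open>Cov(Z\<^sub>i, L) = (C *v lam) $ i = x_pf $ i\<close> and \<open>Var L = lam \<bullet> (C *v lam) = 1 / l_pf\<close>. The formula for the
  correlation is the quotient of these. For comonotonicity, \<open>(Z\<^sub>i, L)\<close> is bivariate normal, so
  \<open>E[exp Z\<^sub>i | L] = K * exp (a * L)\<close> with \<open>K > 0\<close> and the regression slope
  \<open>a = Cov(Z\<^sub>i, L) / Var L = l_pf * x_pf $ i\<close>; this is increasing in \<open>L\<close> because the
  Perron-Frobenius eigenvector is positive.

  The formula for the conditional expectation would usually come from the independence of \<open>L\<close> and
  \<open>Z\<^sub>i - a * L\<close>. Here joint normality means that linear combinations are normal, and from this a
  one-dimensional argument is shorter. Reweight the probability measure by the normalised densities
  \<open>exp Z\<^sub>i\<close> and \<open>exp (a * L)\<close>. Under either one, the moment generating function of \<open>L\<close> is a quotient of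
  exponential moments of linear combinations, and for the above \<open>a\<close> the two quotients agree
  (\<open>cond_exp_given_exp_normal\<close>). So \<open>L\<close> has the same law under both
  (\<open>real_distribution_eqI_mgf\<close>). Equality of the two laws on Borel sets is, up to the
  constant factor \<open>K\<close>, the defining property of the conditional expectation
  (\<open>cond_exp_given_exp\<close>).

  That moment generating functions determine laws is reduced to Levy's uniqueness theorem for
  characteristic functions: if all real exponential moments are finite, then both transforms are given
  by one and the same everywhere convergent power series, whose coefficients can be read off on the
  real line.\<close>

section \<open>Laws with finite exponential moments\<close>

text \<open>The type of \<open>z\<close> is left open so that the same coefficients serve for real \<open>z\<close> (the moment
  generating function) and for imaginary \<open>z\<close> (the characteristic function). Sum and integral may be
  exchanged because \<open>exp (r * \<bar>x\<bar>) \<le> exp (r * x) + exp (- r * x)\<close> dominates the partial sums, where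
  \<open>r = norm z\<close>.\<close>

lemma exp_moment_series:
  fixes z :: "'b :: {real_normed_field, banach, second_countable_topology}"
  assumes sets: "sets \<mu> = sets borel"
    and mgf: "\<And>t. integrable \<mu> (\<lambda>x::real. exp (t * x))"
  shows "(\<lambda>n. of_real ((LINT x|\<mu>. x ^ n) / fact n) * z ^ n) sums
           (LINT x|\<mu>. exp (z * of_real x))"
proof -
  have [measurable_cong]: "sets \<mu> = sets borel" by (fact sets)
  define r where "r = norm z"
  have powers: "integrable \<mu> (\<lambda>x. x ^ n)" for n :: nat
  proof (rule Bochner_Integration.integrable_bound)
    show "integrable \<mu> (\<lambda>x. fact n * (exp (1 * x) + exp (-1 * x)))"
      by (intro integrable_mult_right Bochner_Integration.integrable_add mgf)
    have "\<bar>x\<bar> ^ n \<le> fact n * exp \<bar>x\<bar>" for x :: real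
    proof -
      have "(\<Sum>k\<in>{n}. \<bar>x\<bar> ^ k /\<^sub>R fact k) \<le> exp \<bar>x\<bar>"
        unfolding sums_unique[OF exp_converges[of "\<bar>x\<bar>"]]
        using exp_converges[of "\<bar>x\<bar>"] by (intro sum_le_suminf) (auto simp: sums_iff)
      then show ?thesis by (simp add: field_simps)
    qed
    moreover have "exp \<bar>x\<bar> \<le> exp x + exp (-x)" for x :: real
      by (cases "x \<ge> 0") auto
    ultimately show "AE x in \<mu>. norm (x ^ n) \<le> norm (fact n * (exp (1 * x) + exp (-1 * x)) :: real)"
      by (intro AE_I2) (fastforce simp: power_abs intro: order_trans mult_left_mono)
  qed measurable
  have summand: "(z * of_real x) ^ n /\<^sub>R fact n = of_real (x ^ n) * (z ^ n /\<^sub>R fact n)" for x :: real and n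
    by (simp add: power_mult_distrib scaleR_conv_of_real mult_ac)
  have int: "(LINT x|\<mu>. (\<Sum>k<n. (z * of_real x) ^ k /\<^sub>R fact k)) =
        (\<Sum>k<n. of_real ((LINT x|\<mu>. x ^ k) / fact k) * z ^ k)" for n
    unfolding summand using powers
    by (subst Bochner_Integration.integral_sum)
       (auto simp: scaleR_conv_of_real divide_inverse mult_ac simp flip: of_real_power)
  have "(\<lambda>n. LINT x|\<mu>. (\<Sum>k<n. (z * of_real x) ^ k /\<^sub>R fact k))
          \<longlonglongrightarrow> (LINT x|\<mu>. exp (z * of_real x))"
  proof (rule integral_dominated_convergence)
    show "integrable \<mu> (\<lambda>x. exp (r * x) + exp (- r * x))"
      by (intro Bochner_Integration.integrable_add mgf)
    show "AE x in \<mu>. (\<lambda>n. \<Sum>k<n. (z * of_real x) ^ k /\<^sub>R fact k) \<longlonglongrightarrow> exp (z * of_real x)"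
      using exp_converges by (auto simp: sums_def)
    show "AE x in \<mu>. norm (\<Sum>k<n. (z * of_real x) ^ k /\<^sub>R fact k) \<le> exp (r * x) + exp (- r * x)" for n
    proof (rule AE_I2)
      fix x
      have "norm (\<Sum>k<n. (z * of_real x) ^ k /\<^sub>R fact k) \<le> (\<Sum>k<n. (r * \<bar>x\<bar>) ^ k /\<^sub>R fact k)"
        by (rule order_trans[OF norm_sum]) (simp add: r_def norm_power norm_mult)
      also have "\<dots> \<le> exp (r * \<bar>x\<bar>)"
        unfolding sums_unique[OF exp_converges[of "r * \<bar>x\<bar>"]]
        using exp_converges[of "r * \<bar>x\<bar>"] by (intro sum_le_suminf) (auto simp: r_def sums_iff)
      also have "\<dots> \<le> exp (r * x) + exp (- r * x)"
        by (cases "x \<ge> 0") auto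
      finally show "norm (\<Sum>k<n. (z * of_real x) ^ k /\<^sub>R fact k) \<le> exp (r * x) + exp (- r * x)" .
    qed
  qed measurable
  then show ?thesis
    unfolding int sums_def .
qed

text \<open>The series with coefficients \<open>a n - b n\<close> vanishes identically. If these are zero below \<open>n\<close>, then
  dividing the series by \<open>t ^ n\<close> and letting \<open>t\<close> tend to \<open>0\<close> shows that the \<open>n\<close>-th one is zero too.\<close>

lemma powser_coeffs_unique:
  fixes a b :: "nat \<Rightarrow> real"
  assumes "\<And>t. (\<lambda>n. a n * t ^ n) sums f t" "\<And>t. (\<lambda>n. b n * t ^ n) sums f t"
  shows "a = b"
proof -
  have 0: "(\<lambda>n. (a n - b n) * t ^ n) sums 0" for t
    using sums_diff[OF assms(1)[of t] assms(2)[of t]] by (simp add: algebra_simps)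
  have "a n - b n = 0" for n
  proof (induction n rule: less_induct)
    case (less n)
    have "(\<lambda>m. (a (m + n) - b (m + n)) * t ^ m) sums 0" if "t \<noteq> 0" for t
    proof -
      have "(\<lambda>m. (a (m + n) - b (m + n)) * t ^ (m + n)) sums 0"
        using sums_iff_shift[of "\<lambda>m. (a m - b m) * t ^ m" n 0] 0[of t] less.IH by simp
      moreover have "(a (m + n) - b (m + n)) * t ^ (m + n) / t ^ n = (a (m + n) - b (m + n)) * t ^ m" for m
        using that by (simp add: power_add)
      ultimately show ?thesis
        using sums_divide[of "\<lambda>m. (a (m + n) - b (m + n)) * t ^ (m + n)" 0 "t ^ n"] by simp
    qed
    then have "((\<lambda>_. 0) \<longlongrightarrow> a (0 + n) - b (0 + n)) (at (0::real))"
      by (intro powser_limit_0_strong[of 1]) auto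
    then show ?case
      using tendsto_const_iff[of "at (0::real)" "0::real"] by simp
  qed
  then show ?thesis by auto
qed

text \<open>Equality on the real line gives equal moments, and the moments give the characteristic functions:
  analytic continuation to the imaginary axis, done on the level of power series.\<close>

lemma real_distribution_eqI_mgf:
  assumes "real_distribution \<mu>" "real_distribution \<nu>"
    and \<mu>: "\<And>t. integrable \<mu> (\<lambda>x. exp (t * x))"
    and \<nu>: "\<And>t. integrable \<nu> (\<lambda>x. exp (t * x))"
    and eq: "\<And>t. (LINT x|\<mu>. exp (t * x)) = (LINT x|\<nu>. exp (t * x))"
  shows "\<mu> = \<nu>"
proof (rule Levy_uniqueness)
  have sets: "sets \<mu> = sets borel" "sets \<nu> = sets borel"
    using assms(1,2) by (simp_all add: real_distribution_def real_distribution_axioms_def)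
  have moments: "(\<lambda>n. (LINT x|\<mu>. x ^ n) / fact n) = (\<lambda>n. (LINT x|\<nu>. x ^ n) / fact n)"
    using exp_moment_series[OF sets(1) \<mu>, where 'b = real]
          exp_moment_series[OF sets(2) \<nu>, where 'b = real]
    by (intro powser_coeffs_unique[where f = "\<lambda>t. LINT x|\<mu>. exp (t * x)"]) (simp_all add: eq)
  show "char \<mu> = char \<nu>"
  proof
    fix t
    have char: "char \<rho> t = (LINT x|\<rho>. exp (\<i> * of_real t * of_real x))" for \<rho>
      by (simp add: char_def mult_ac)
    show "char \<mu> t = char \<nu> t"
      unfolding char
      using exp_moment_series[OF sets(1) \<mu>, of "\<i> * of_real t"]
            exp_moment_series[OF sets(2) \<nu>, of "\<i> * of_real t"]
      by (simp only: moments[THEN fun_cong] sums_iff)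
  qed
qed (use assms in auto)

section \<open>Conditional expectations by exponential tilting\<close>

context prob_space
begin

text \<open>Also known as the Esscher transform. The normalising constant makes it a probability measure
  whenever \<open>exp U\<close> is integrable.\<close>

definition exp_tilt :: "('a \<Rightarrow> real) \<Rightarrow> 'a measure" where
  "exp_tilt U = density M (\<lambda>\<omega>. ennreal (exp (U \<omega>) / expectation (\<lambda>\<omega>. exp (U \<omega>))))"

lemma expectation_exp_pos:
  fixes U :: "'a \<Rightarrow> real"
  assumes "integrable M (\<lambda>\<omega>. exp (U \<omega>))"
  shows "expectation (\<lambda>\<omega>. exp (U \<omega>)) > 0"
  using assms by (intro expectation_greater) auto

lemma real_distribution_exp_tilt:
  assumes Y: "random_variable borel Y" and U: "integrable M (\<lambda>\<omega>. exp (U \<omega>))"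
  shows "real_distribution (distr (exp_tilt U) borel Y)"
proof -
  have [measurable]: "(\<lambda>\<omega>. exp (U \<omega>)) \<in> borel_measurable M"
    using U by auto
  note pos = expectation_exp_pos[OF U]
  have "prob_space (exp_tilt U)"
  proof
    have "emeasure (exp_tilt U) (space (exp_tilt U)) =
        (\<integral>\<^sup>+ \<omega>. ennreal (exp (U \<omega>) / expectation (\<lambda>\<omega>. exp (U \<omega>))) \<partial>M)"
      by (simp add: exp_tilt_def emeasure_density cong: nn_integral_cong)
    also have "\<dots> = ennreal (expectation (\<lambda>\<omega>. exp (U \<omega>) / expectation (\<lambda>\<omega>. exp (U \<omega>))))"
      using U pos by (intro nn_integral_eq_integral) auto
    also have "\<dots> = 1" using pos by simp
    finally show "emeasure (exp_tilt U) (space (exp_tilt U)) = 1" .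
  qed
  then show ?thesis
    using Y by (intro prob_space.real_distribution_distr) (auto simp: exp_tilt_def)
qed

text \<open>Up to the factors \<open>E[exp X]\<close> and \<open>E[exp (a * Y)]\<close>, the integrals of \<open>exp X\<close> and \<open>exp (a * Y)\<close> over
  \<open>{Y \<in> B}\<close> are the probabilities of \<open>B\<close> under the laws of \<open>Y\<close> in the two tilted measures. The
  hypothesis \<open>eq\<close> says that these laws have the same moment generating function. Hence
  \<open>exp X\<close> and \<open>K * exp (a * Y)\<close> have equal integrals over every event determined by \<open>Y\<close>.\<close>

lemma cond_exp_given_exp:
  fixes X Y :: "'a \<Rightarrow> real"
  assumes Y[measurable]: "random_variable borel Y"
    and XY: "\<And>t. integrable M (\<lambda>\<omega>. exp (X \<omega> + t * Y \<omega>))"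
    and YY: "\<And>t. integrable M (\<lambda>\<omega>. exp (t * Y \<omega>))"
    and eq: "\<And>t. expectation (\<lambda>\<omega>. exp (X \<omega> + t * Y \<omega>)) / expectation (\<lambda>\<omega>. exp (X \<omega>)) =
                expectation (\<lambda>\<omega>. exp ((a + t) * Y \<omega>)) / expectation (\<lambda>\<omega>. exp (a * Y \<omega>))"
  defines "K \<equiv> expectation (\<lambda>\<omega>. exp (X \<omega>)) / expectation (\<lambda>\<omega>. exp (a * Y \<omega>))"
  shows "K > 0" and "AE \<omega> in M. cond_exp_given M (\<lambda>\<omega>. exp (X \<omega>)) Y \<omega> = K * exp (a * Y \<omega>)"
proof -
  have X: "integrable M (\<lambda>\<omega>. exp (X \<omega>))"
    using XY[of 0] by simp
  note pos = expectation_exp_pos[OF X] expectation_exp_pos[OF YY[of a]]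
  then show "K > 0" by (simp add: K_def)
  have mgf: "(LINT x|distr (exp_tilt U) borel Y. exp (t * x)) =
       expectation (\<lambda>\<omega>. exp (U \<omega> + t * Y \<omega>)) / expectation (\<lambda>\<omega>. exp (U \<omega>))" (is ?mgf)
    "integrable (distr (exp_tilt U) borel Y) (\<lambda>x. exp (t * x))" (is ?int)
    if U: "\<And>t. integrable M (\<lambda>\<omega>. exp (U \<omega> + t * Y \<omega>))" for U t
  proof -
    have U0: "integrable M (\<lambda>\<omega>. exp (U \<omega>))" using U[of 0] by simp
    then have [measurable]: "(\<lambda>\<omega>. exp (U \<omega>)) \<in> borel_measurable M" by auto
    have p: "expectation (\<lambda>\<omega>. exp (U \<omega>)) > 0"
      by (rule expectation_exp_pos[OF U0])
    have *: "(exp (U \<omega>) / expectation (\<lambda>\<omega>. exp (U \<omega>))) *\<^sub>R exp (t * Y \<omega>) =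
        exp (U \<omega> + t * Y \<omega>) / expectation (\<lambda>\<omega>. exp (U \<omega>))" for \<omega>
      by (simp add: exp_add)
    show ?mgf unfolding exp_tilt_def
      using p by (simp add: integral_distr integral_density * del: real_scaleR_def)
    show ?int unfolding exp_tilt_def
      using p U[of t] by (simp add: integrable_distr_eq integrable_density * del: real_scaleR_def)
  qed
  have YY': "integrable M (\<lambda>\<omega>. exp (a * Y \<omega> + t * Y \<omega>))" for t
    using YY[of "a + t"] by (simp add: algebra_simps)
  note mgfX = mgf[of X, OF XY] and mgfY = mgf[of "\<lambda>\<omega>. a * Y \<omega>", OF YY']
  have tilts: "distr (exp_tilt X) borel Y = distr (exp_tilt (\<lambda>\<omega>. a * Y \<omega>)) borel Y"
  proof (rule real_distribution_eqI_mgf)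
    show "real_distribution (distr (exp_tilt X) borel Y)"
         "real_distribution (distr (exp_tilt (\<lambda>\<omega>. a * Y \<omega>)) borel Y)"
      by (rule real_distribution_exp_tilt[OF Y X], rule real_distribution_exp_tilt[OF Y YY])
    show "(LINT x|distr (exp_tilt X) borel Y. exp (t * x)) =
          (LINT x|distr (exp_tilt (\<lambda>\<omega>. a * Y \<omega>)) borel Y. exp (t * x))" for t
      using eq[of t] unfolding mgfX(1) mgfY(1)
      by (simp only: distrib_right)
  qed (use mgfX(2) mgfY(2) in auto)
  let ?F = "vimage_algebra (space M) Y borel"
  have sub: "subalgebra M ?F"
    unfolding subalgebra_def by (auto simp: sets_vimage_algebra2)
  interpret F: finite_measure_subalgebra M ?F
    by unfold_locales (rule sub)
  show "AE \<omega> in M. cond_exp_given M (\<lambda>\<omega>. exp (X \<omega>)) Y \<omega> = K * exp (a * Y \<omega>)"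
    unfolding cond_exp_given_def
  proof (rule F.real_cond_exp_charact)
    have [measurable]: "Y \<in> borel_measurable ?F"
      by (rule measurable_vimage_algebra1) auto
    show "(\<lambda>\<omega>. K * exp (a * Y \<omega>)) \<in> borel_measurable ?F" by measurable
    fix A assume "A \<in> sets ?F"
    then obtain B where B[measurable]: "B \<in> sets borel" and A: "A = Y -` B \<inter> space M"
      by (auto simp: sets_vimage_algebra2)
    have tilt: "measure (distr (exp_tilt U) borel Y) B =
        (LINT \<omega>:A|M. exp (U \<omega>)) / expectation (\<lambda>\<omega>. exp (U \<omega>))"
      if U: "integrable M (\<lambda>\<omega>. exp (U \<omega>))" for U
    proof -
      have [measurable]: "(\<lambda>\<omega>. exp (U \<omega>)) \<in> borel_measurable M" using U by auto
      have Am[measurable]: "A \<in> sets M" unfolding A by measurable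
      have p: "expectation (\<lambda>\<omega>. exp (U \<omega>)) > 0"
        by (rule expectation_exp_pos[OF U])
      have "measure (distr (exp_tilt U) borel Y) B = measure (exp_tilt U) A"
        by (simp add: measure_distr exp_tilt_def A)
      also have "\<dots> = (LINT \<omega>|exp_tilt U. indicator A \<omega>)"
        using Am sets.sets_into_space[OF Am] by (simp add: exp_tilt_def Int_absorb1)
      also have "\<dots> = (LINT \<omega>|M. indicator A \<omega> * exp (U \<omega>) / expectation (\<lambda>\<omega>. exp (U \<omega>)))"
        unfolding exp_tilt_def using p by (subst integral_density) (auto simp: mult_ac)
      finally show ?thesis by (simp add: set_lebesgue_integral_def)
    qed
    show "(LINT \<omega>:A|M. exp (X \<omega>)) = (LINT \<omega>:A|M. K * exp (a * Y \<omega>))"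
      using tilt[OF X] tilt[OF YY[of a]] pos unfolding tilts K_def by (simp add: field_simps)
  qed (use X YY in auto)
qed


section \<open>Normal random variables\<close>

lemma univariate_normal_moments:
  assumes "univariate_normal M X"
  shows "integrable M X" and "integrable M (\<lambda>\<omega>. (X \<omega>)\<^sup>2)"
    and "integrable M (\<lambda>\<omega>. exp (X \<omega>))"
    and "expectation (\<lambda>\<omega>. exp (X \<omega>)) = exp (expectation X + variance X / 2)"
proof -
  have X[measurable]: "X \<in> borel_measurable M"
    using assms by (simp add: univariate_normal_def)
  from assms consider (point) m where "distr M borel X = return borel m"
    | (normal) m s where "s > 0" "distr M borel X = density lborel (\<lambda>x. ennreal (normal_density m s x))"
    by (auto simp: univariate_normal_def)
  then have "integrable M X \<and> integrable M (\<lambda>\<omega>. (X \<omega>)\<^sup>2) \<and> integrable M (\<lambda>\<omega>. exp (X \<omega>)) \<and>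
    expectation (\<lambda>\<omega>. exp (X \<omega>)) = exp (expectation X + variance X / 2)"
  proof cases
    case point
    have "AE x in distr M borel X. x = m"
      unfolding point by (simp add: AE_return)
    then have ae: "AE \<omega> in M. X \<omega> = m"
      by (simp add: AE_distr_iff)
    have const: "integrable M (\<lambda>\<omega>. f (X \<omega>))" "expectation (\<lambda>\<omega>. f (X \<omega>)) = f m"
      if [measurable]: "f \<in> borel_measurable borel" for f :: "real \<Rightarrow> real"
    proof -
      have "AE \<omega> in M. f (X \<omega>) = f m" using ae by eventually_elim simp
      then show "integrable M (\<lambda>\<omega>. f (X \<omega>))" "expectation (\<lambda>\<omega>. f (X \<omega>)) = f m"
        using integrable_cong_AE[of "\<lambda>\<omega>. f (X \<omega>)" M "\<lambda>_. f m"]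
              integral_cong_AE[of "\<lambda>\<omega>. f (X \<omega>)" M "\<lambda>_. f m"] by (auto simp: prob_space)
    qed
    from const[of "\<lambda>x. x"] const[of "\<lambda>x. x\<^sup>2"] const[of exp] const[of "\<lambda>x. (x - m)\<^sup>2"]
    show ?thesis by simp
  next
    case normal
    have "distr M lborel X = distr M borel X"
      by (rule distr_cong) auto
    then have D: "distributed M lborel X (normal_density m s)"
      using normal by (simp add: distributed_def)
    note E = normal_distributed_expectation[OF normal(1) D]
    note V = normal_distributed_variance[OF normal(1) D, unfolded E]
    have int: "integrable M (\<lambda>\<omega>. f (X \<omega>)) \<longleftrightarrow> integrable lborel (\<lambda>x. normal_density m s x * f x)"
      "expectation (\<lambda>\<omega>. f (X \<omega>)) = (LINT x|lborel. normal_density m s x * f x)"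
      if "f \<in> borel_measurable borel" for f :: "real \<Rightarrow> real"
      using distributed_integrable[OF D, of f] distributed_integral[OF D, of f] that by simp_all
    have sq: "normal_density m s x * x\<^sup>2 = normal_density m s x * (x - m) ^ 2 +
        2 * m * (normal_density m s x * x) - m\<^sup>2 * normal_density m s x" for x
      by (simp add: power2_eq_square algebra_simps)
    \<comment> \<open>Completing the square: an exponential tilt shifts the mean of a normal density by \<open>s\<^sup>2\<close>.\<close>
    have tilt: "normal_density m s x * exp x = exp (m + s\<^sup>2 / 2) * normal_density (m + s\<^sup>2) s x" for x
      unfolding normal_density_def using normal(1)
      by (simp add: exp_add[symmetric] field_simps power2_eq_square)
    have "integrable M X"
      using int(1)[of "\<lambda>x. x"] integrable_normal_moment_nz_1[OF normal(1)] by simp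
    moreover have "integrable M (\<lambda>\<omega>. (X \<omega>)\<^sup>2)"
      unfolding int(1)[of "\<lambda>x. x\<^sup>2", simplified] sq
      using normal(1)
      by (intro Bochner_Integration.integrable_add Bochner_Integration.integrable_diff
          integrable_mult_right integrable_normal_moment integrable_normal_moment_nz_1
          integrable_normal_density)
    moreover have "integrable M (\<lambda>\<omega>. exp (X \<omega>))"
      using int(1)[of exp] normal(1) by (simp add: tilt)
    moreover have "expectation (\<lambda>\<omega>. exp (X \<omega>)) = exp (m + s\<^sup>2 / 2)"
      using int(2)[of exp] normal(1) by (simp add: tilt)
    ultimately show ?thesis by (simp add: E V)
  qed
  then show "integrable M X" and "integrable M (\<lambda>\<omega>. (X \<omega>)\<^sup>2)"
    and "integrable M (\<lambda>\<omega>. exp (X \<omega>))"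
    and "expectation (\<lambda>\<omega>. exp (X \<omega>)) = exp (expectation X + variance X / 2)" by auto
qed

lemma integrable_centered_product:
  fixes X Y :: "'a \<Rightarrow> real"
  assumes X: "integrable M X" "integrable M (\<lambda>\<omega>. (X \<omega>)\<^sup>2)"
    and Y: "integrable M Y" "integrable M (\<lambda>\<omega>. (Y \<omega>)\<^sup>2)"
  shows "integrable M (\<lambda>\<omega>. (X \<omega> - expectation X) * (Y \<omega> - expectation Y))"
proof -
  have [measurable]: "X \<in> borel_measurable M" "Y \<in> borel_measurable M"
    using X Y by auto
  have "integrable M (\<lambda>\<omega>. X \<omega> * Y \<omega>)"
  proof (rule Bochner_Integration.integrable_bound)
    show "integrable M (\<lambda>\<omega>. (X \<omega>)\<^sup>2 + (Y \<omega>)\<^sup>2)" using X Y by simp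
    have "\<bar>x * y\<bar> \<le> x\<^sup>2 + y\<^sup>2" for x y :: real
      using sum_squares_bound[of "\<bar>x\<bar>" "\<bar>y\<bar>"] abs_ge_zero[of "x * y"]
      unfolding abs_mult power2_abs by linarith
    then show "AE \<omega> in M. norm (X \<omega> * Y \<omega>) \<le> norm ((X \<omega>)\<^sup>2 + (Y \<omega>)\<^sup>2)"
      by (intro AE_I2) (simp add: abs_mult)
  qed measurable
  then show ?thesis using X Y by (simp add: algebra_simps)
qed

lemma covariance_lin_comb:
  fixes Z :: "'a \<Rightarrow> real ^ 'n"
  assumes X: "integrable M X" "integrable M (\<lambda>\<omega>. (X \<omega>)\<^sup>2)"
    and Z: "\<And>j. integrable M (\<lambda>\<omega>. Z \<omega> $ j)" "\<And>j. integrable M (\<lambda>\<omega>. (Z \<omega> $ j)\<^sup>2)"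
  shows "covariance M X (lin_comb c Z) = (\<Sum>j\<in>UNIV. c $ j * covariance M X (\<lambda>\<omega>. Z \<omega> $ j))"
proof -
  have "expectation (lin_comb c Z) = (\<Sum>j\<in>UNIV. c $ j * expectation (\<lambda>\<omega>. Z \<omega> $ j))"
    unfolding lin_comb_def using Z by simp
  then have "(X \<omega> - expectation X) * (lin_comb c Z \<omega> - expectation (lin_comb c Z)) =
      (\<Sum>j\<in>UNIV. c $ j * ((X \<omega> - expectation X) * (Z \<omega> $ j - expectation (\<lambda>\<omega>. Z \<omega> $ j))))" for \<omega>
    by (simp add: lin_comb_def sum_distrib_left algebra_simps flip: sum_subtractf)
  then show ?thesis
    unfolding covariance_def using integrable_centered_product[OF X Z] by simp
qed

lemma variance_add_scaled:
  assumes X: "integrable M X" "integrable M (\<lambda>\<omega>. (X \<omega>)\<^sup>2)"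
    and Y: "integrable M Y" "integrable M (\<lambda>\<omega>. (Y \<omega>)\<^sup>2)"
  shows "variance (\<lambda>\<omega>. X \<omega> + t * Y \<omega>) = variance X + 2 * t * covariance M X Y + t\<^sup>2 * variance Y"
proof -
  have E: "expectation (\<lambda>\<omega>. X \<omega> + t * Y \<omega>) = expectation X + t * expectation Y"
    using X Y by simp
  have "(X \<omega> + t * Y \<omega> - (expectation X + t * expectation Y))\<^sup>2 =
      (X \<omega> - expectation X)\<^sup>2 + 2 * t * ((X \<omega> - expectation X) * (Y \<omega> - expectation Y)) +
      t\<^sup>2 * (Y \<omega> - expectation Y)\<^sup>2" for \<omega>
    by (simp add: power2_eq_square algebra_simps)
  then show ?thesis
    unfolding E covariance_def
    using integrable_centered_product[OF X Y] integrable_centered_product[OF X X]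
      integrable_centered_product[OF Y Y] by (simp add: power2_eq_square)
qed

text \<open>The slope \<open>a = Cov(X, Y) / Var Y\<close> is the one for which \<open>exp X\<close> and \<open>exp (a * Y)\<close> tilt the law of
  \<open>Y\<close> in the same way: tilting by a jointly normal variable shifts the mean of \<open>Y\<close> by the covariance
  with that variable and keeps the variance, and \<open>Cov(a * Y, Y) = a * Var Y = Cov(X, Y)\<close>.
  The identity \<open>exponents\<close> in the proof expresses this in terms of moment generating functions.\<close>

lemma cond_exp_given_exp_normal:
  fixes X Y :: "'a \<Rightarrow> real"
  assumes normal: "\<And>s t. univariate_normal M (\<lambda>\<omega>. s * X \<omega> + t * Y \<omega>)"
    and nz: "variance Y \<noteq> 0"
  obtains K where "K > 0"
    "AE \<omega> in M. cond_exp_given M (\<lambda>\<omega>. exp (X \<omega>)) Y \<omega> =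
                   K * exp (covariance M X Y / variance Y * Y \<omega>)"
proof -
  define a where "a = covariance M X Y / variance Y"
  have nX: "univariate_normal M (\<lambda>\<omega>. X \<omega> + t * Y \<omega>)"
    and nY: "univariate_normal M (\<lambda>\<omega>. t * Y \<omega>)" for t
    using normal[of 1 t] normal[of 0 t] by simp_all
  have X: "integrable M X" "integrable M (\<lambda>\<omega>. (X \<omega>)\<^sup>2)"
    using univariate_normal_moments(1,2)[OF nX[of 0]] by simp_all
  have Y: "integrable M Y" "integrable M (\<lambda>\<omega>. (Y \<omega>)\<^sup>2)"
    using univariate_normal_moments(1,2)[OF nY[of 1]] by simp_all
  have mX: "expectation (\<lambda>\<omega>. exp (X \<omega> + t * Y \<omega>)) =
      exp (expectation X + t * expectation Y +
           (variance X + 2 * t * covariance M X Y + t\<^sup>2 * variance Y) / 2)" for t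
    unfolding univariate_normal_moments(4)[OF nX] variance_add_scaled[OF X Y] using X Y by simp
  have mY: "expectation (\<lambda>\<omega>. exp (t * Y \<omega>)) = exp (t * expectation Y + t\<^sup>2 * variance Y / 2)" for t
    using univariate_normal_moments(4)[OF nY[of t]] variance_add_scaled[of "\<lambda>_. 0" Y t] Y
    by (simp add: covariance_def)
  have cov: "covariance M X Y = a * variance Y"
    using nz by (simp add: a_def)
  have mX0: "expectation (\<lambda>\<omega>. exp (X \<omega>)) = exp (expectation X + variance X / 2)"
    using mX[of 0] by simp
  have exponents: "(p + t * q + (u + 2 * t * (a * v) + t\<^sup>2 * v) / 2) - (p + u / 2) =
      ((a + t) * q + (a + t)\<^sup>2 * v / 2) - (a * q + a\<^sup>2 * v / 2)" for p q t u v :: real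
    by (simp add: field_simps power2_eq_square)
  have eq: "expectation (\<lambda>\<omega>. exp (X \<omega> + t * Y \<omega>)) / expectation (\<lambda>\<omega>. exp (X \<omega>)) =
      expectation (\<lambda>\<omega>. exp ((a + t) * Y \<omega>)) / expectation (\<lambda>\<omega>. exp (a * Y \<omega>))" for t
    by (simp only: mX mX0 mY cov exp_diff[symmetric] exponents)
  have "random_variable borel Y" using Y by auto
  note * = cond_exp_given_exp[OF this univariate_normal_moments(3)[OF nX]
      univariate_normal_moments(3)[OF nY] eq]
  show thesis
    by (rule that[OF *[unfolded a_def]])
qed

end

section \<open>The Perron-Frobenius direction\<close>

text \<open>The predicate \<open>pf_eigenvector\<close> comes with its own existentially quantified eigenvalue; strict
  dominance identifies it with the given one.\<close>

lemma pf_eigenvalue_unique: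
  assumes "pf_eigenvalue A k" "pf_eigenvalue A l"
  shows "k = l"
proof (rule ccontr)
  assume "k \<noteq> l"
  then have "cmod (of_real k) < l" "cmod (of_real l) < k"
    using assms by (auto simp: pf_eigenvalue_def simple_eigenvalue_def)
  then show False by simp
qed

theorem theorem2p3:
  fixes M :: "'a measure"
    and Z :: "'a \<Rightarrow> real ^ 'n"
    and \<mu> \<alpha> x_pf lam :: "real ^ 'n"
    and C :: "real ^ 'n ^ 'n"
    and l_pf :: real
    and S L :: "'a \<Rightarrow> real"
  assumes "prob_space M"
    and "multivariate_normal M Z \<mu> C"
    and "invertible C"
    and "\<forall>i j. C $ i $ j > 0"
    and "\<forall>i. \<alpha> $ i > 0"
    and "S = (\<lambda>\<omega>. \<Sum>i\<in>UNIV. \<alpha> $ i * exp (Z \<omega> $ i))"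
    and "pf_eigenvalue C l_pf"
    and "pf_eigenvector C x_pf" and "norm x_pf = 1"
    and "lam = matrix_inv C *v x_pf"
    and "L = lin_comb lam Z"
  shows "(AE \<omega> in M. cond_exp_given M S L \<omega> =
            (\<Sum>i\<in>UNIV. cond_exp_given M (\<lambda>\<omega>. \<alpha> $ i * exp (Z \<omega> $ i)) L \<omega>)) \<and>
         defines_comonotonic_sum M \<alpha> Z lam \<and>
         (\<forall>i. correlation M (\<lambda>\<omega>. Z \<omega> $ i) L =
               sqrt l_pf * x_pf $ i / std_dev M (\<lambda>\<omega>. Z \<omega> $ i))"
proof -
  interpret prob_space M by fact
  have l: "l_pf > 0" and x: "\<And>i. x_pf $ i > 0" and eig: "C *v x_pf = l_pf *s x_pf"
    using assms(7,8) pf_eigenvalue_unique by (auto simp: pf_eigenvector_def pf_eigenvalue_def)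
  have Clam: "C *v lam = x_pf"
    unfolding assms(10) using assms(3) someI_ex[of "\<lambda>B. C ** B = mat 1 \<and> B ** C = mat 1"]
    by (simp add: matrix_vector_mul_assoc invertible_def matrix_inv_def)
  \<comment> \<open>Inverting \<open>C\<close> only rescales its eigenvector.\<close>
  have lam: "lam = (1 / l_pf) *s x_pf"
  proof -
    have "C *v ((1 / l_pf) *s x_pf) = C *v lam"
      unfolding Clam using l eig by (simp add: vector_scalar_commute vec_eq_iff)
    then show ?thesis
      using inj_matrix_vector_mult[OF assms(3)] by (auto dest: injD)
  qed
  have normal: "univariate_normal M (lin_comb t Z)" for t
    using assms(2) by (simp add: multivariate_normal_def lin_comb_def)
  have comb: "univariate_normal M (\<lambda>\<omega>. s * Z \<omega> $ i + t * L \<omega>)" for s t i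
  proof -
    have "(\<Sum>j\<in>UNIV. axis i 1 $ j * Z \<omega> $ j) = Z \<omega> $ i" for \<omega>
      using inner_axis'[of i 1 "Z \<omega>"] by (simp add: inner_vec_def)
    then have "(\<lambda>\<omega>. s * Z \<omega> $ i + t * L \<omega>) = lin_comb (s *s axis i 1 + t *s lam) Z"
      unfolding assms(11) lin_comb_def
      by (simp add: algebra_simps sum.distrib flip: sum_distrib_left)
    then show ?thesis using normal by simp
  qed
  have nZ: "univariate_normal M (\<lambda>\<omega>. Z \<omega> $ i)" for i
    using comb[of 1 i 0] by simp
  have nL: "univariate_normal M L"
    using normal assms(11) by simp
  note Z = univariate_normal_moments[OF nZ] and L = univariate_normal_moments[OF nL]
  have covZL: "covariance M (\<lambda>\<omega>. Z \<omega> $ i) L = x_pf $ i" for i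
  proof -
    have "covariance M (\<lambda>\<omega>. Z \<omega> $ i) L = (C *v lam) $ i"
      unfolding assms(11) covariance_lin_comb[OF Z(1,2) Z(1,2)] matrix_vector_mult_def
      using assms(2) by (simp add: multivariate_normal_def mult_ac)
    then show ?thesis by (simp add: Clam)
  qed
  have varL: "variance L = 1 / l_pf"
  proof -
    have "variance L = covariance M L (lin_comb lam Z)"
      by (simp add: covariance_def power2_eq_square assms(11))
    also have "\<dots> = (\<Sum>j\<in>UNIV. lam $ j * covariance M (\<lambda>\<omega>. Z \<omega> $ j) L)"
      unfolding covariance_lin_comb[OF L(1,2) Z(1,2)] by (simp add: covariance_def mult_ac)
    also have "\<dots> = (x_pf \<bullet> x_pf) / l_pf"
      by (simp add: covZL lam inner_vec_def sum_divide_distrib)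
    also have "x_pf \<bullet> x_pf = 1"
      using assms(9) by (simp add: dot_square_norm)
    finally show ?thesis .
  qed
  let ?F = "vimage_algebra (space M) L borel"
  have "L \<in> borel_measurable M" using L(1) by auto
  then have "subalgebra M ?F"
    unfolding subalgebra_def by (auto simp: sets_vimage_algebra2)
  then interpret F: finite_measure_subalgebra M ?F
    by unfold_locales
  have "AE \<omega> in M. cond_exp_given M S L \<omega> =
            (\<Sum>i\<in>UNIV. cond_exp_given M (\<lambda>\<omega>. \<alpha> $ i * exp (Z \<omega> $ i)) L \<omega>)"
    unfolding cond_exp_given_def assms(6)
    by (rule F.real_cond_exp_sum) (use Z(3) in auto)
  moreover have "defines_comonotonic_sum M \<alpha> Z lam"
    unfolding defines_comonotonic_sum_def nondecreasing_function_of_def assms(11)[symmetric]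
  proof
    fix i
    obtain K where K: "K > 0" and
      ce: "AE \<omega> in M. cond_exp_given M (\<lambda>\<omega>. exp (Z \<omega> $ i)) L \<omega> =
             K * exp (covariance M (\<lambda>\<omega>. Z \<omega> $ i) L / variance L * L \<omega>)"
      using varL l by (auto intro: cond_exp_given_exp_normal[OF comb[of _ i]])
    have slope: "covariance M (\<lambda>\<omega>. Z \<omega> $ i) L / variance L = l_pf * x_pf $ i"
      by (simp add: covZL varL)
    let ?g = "\<lambda>y. \<alpha> $ i * (K * exp (l_pf * x_pf $ i * y))"
    have "mono ?g"
      using K l x[of i] assms(5) by (intro monoI mult_left_mono) (auto simp: less_imp_le)
    moreover have "AE \<omega> in M. cond_exp_given M (\<lambda>\<omega>. \<alpha> $ i * exp (Z \<omega> $ i)) L \<omega> = ?g (L \<omega>)"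
      using F.real_cond_exp_cmult[OF Z(3)[of i], of "\<alpha> $ i"] ce
      unfolding cond_exp_given_def slope by eventually_elim simp
    ultimately show "\<exists>g. mono g \<and>
        (AE \<omega> in M. cond_exp_given M (\<lambda>\<omega>. \<alpha> $ i * exp (Z \<omega> $ i)) L \<omega> = g (L \<omega>))"
      by blast
  qed
  moreover have "correlation M (\<lambda>\<omega>. Z \<omega> $ i) L =
      sqrt l_pf * x_pf $ i / std_dev M (\<lambda>\<omega>. Z \<omega> $ i)" for i
  proof -
    have "std_dev M L = 1 / sqrt l_pf"
      by (simp add: std_dev_def varL real_sqrt_divide)
    then show ?thesis by (simp add: correlation_def covZL)
  qed
  ultimately show ?thesis by blast
qed

end
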